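(* Let $E_i=A_i\cdot\mathbb{B}^N=\{A_i\mathbf v:\mathbf v\in\mathbb{B}^N\}$, $i=1,2$, be ellipsoids, where $A_1,A_2$ are positive-definite symmetric $N\times N$ real matrices. Then $$\left[\mathrm{Vol}(E_1+E_2)\right]^{1/N}\ \ge\ \mathrm{Vol}(\mathbb{B}^N)^{1/N}\det\left(F(A_1,A_2)\right)^{1/N}\ \ge\ \mathrm{Vol}(\mathbb{B}^N)^{1/N}\det\left(A_1+A_2\right)^{1/N}\ \ge\ \mathrm{Vol}(E_1)^{1/N}+\mathrm{Vol}(E_2)^{1/N},$$ where $$F(A,B):=\left[A^2+2\,A^2\#B^2+B^2\right]^{1/2}.$$
   Context: $\mathbb{B}^N=\{\mathbf x\in\mathbb{R}^N:\|\mathbf x\|<1\}$ is the open unit ball, $\mathrm{Vol}$ is Lebesgue measure on $\mathbb{R}^N$, and $E_1+E_2=\{\mathbf x+\mathbf y:\mathbf x\in E_1,\mathbf y\in E_2\}$ is the Minkowski sum. For positive-definite symmetric matrices $P,Q$, the geometric mean is $P\#Q:=P^{1/2}\left(P^{-1/2}QP^{-1/2}\right)^{1/2}P^{1/2}$, where the exponent $1/2$ denotes the positive-definite symmetric square root. *)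

theory Defs
  imports "HOL-Analysis.Analysis"
begin

definition posdef_sym :: "real ^ 'n ^ 'n \<Rightarrow> bool" where
  "posdef_sym A \<longleftrightarrow> transpose A = A \<and> (\<forall>x. x \<noteq> 0 \<longrightarrow> x \<bullet> (A *v x) > 0)"

(* Meaningful only when P is positive-definite symmetric; the square root is then unique. *)
definition msqrt :: "real ^ 'n ^ 'n \<Rightarrow> real ^ 'n ^ 'n" where
  "msqrt P = (THE R. posdef_sym R \<and> R ** R = P)"

(* The power P^(-1/2) is rendered as the inverse of the positive-definite square root of P. *)
definition geometric_mean :: "real ^ 'n ^ 'n \<Rightarrow> real ^ 'n ^ 'n \<Rightarrow> real ^ 'n ^ 'n" where
  "geometric_mean P Q =
     msqrt P ** msqrt (matrix_inv (msqrt P) ** Q ** matrix_inv (msqrt P)) ** msqrt P"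

(* Matrix squares are written with **, since ^ on this type would be the componentwise power. *)
definition F :: "real ^ 'n ^ 'n \<Rightarrow> real ^ 'n ^ 'n \<Rightarrow> real ^ 'n ^ 'n" where
  "F A B = msqrt (A ** A + 2 *\<^sub>R geometric_mean (A ** A) (B ** B) + B ** B)"

end

theory Submission
  imports Defs
begin

text \<open>
  Write \<open>A, B\<close> for the two matrices. Everything follows from one relative
  polar decomposition: \<open>B = A G U\<close> with \<open>G\<close> positive definite and \<open>U\<close> orthogonal
  (lemma \<open>posdef_relative_polar\<close>). Here \<open>G\<close> is the square root of
  \<open>A\<^sup>-\<^sup>1 B\<^sup>2 A\<^sup>-\<^sup>1\<close>, so it is exactly the middle factor of the geometric mean of \<open>A\<^sup>2\<close> and \<open>B\<^sup>2\<close>,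
  which becomes \<open>A G A\<close>. Consequently \<open>F(A,B)\<^sup>2 = A (I + G)\<^sup>2 A = K K\<^sup>T\<close> with \<open>K = A (I + G)\<close>, and
  \<open>det F(A,B) = det A det (I + G) = det K\<close>.

  \<^item> First inequality. Since an orthogonal map preserves the unit ball, \<open>B\<close> and \<open>A G\<close> have the same
    image of the ball. Hence the Minkowski sum of the ellipsoids contains the image of the ball
    under \<open>K\<close>, whose volume is \<open>det K\<close> times that of the ball.

  \<^item> Second inequality. From \<open>A + B = A (U\<^sup>T + G) U\<close> one needs \<open>\<bar>det (G + U\<^sup>T)\<bar> \<le> det (I + G)\<close>
    (lemma \<open>det_posdef_add_orthogonal_le\<close>). In an eigenbasis of \<open>G\<close> the \<open>i\<close>-th row of \<open>G + U\<^sup>T\<close> has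
    norm at most \<open>d\<^sub>i + 1\<close>, where \<open>d\<^sub>i\<close> is the \<open>i\<close>-th eigenvalue, so this is Hadamard's inequality.

  \<^item> Third inequality. The volume of an ellipsoid is the determinant times that of the ball, so this
    is the Minkowski determinant inequality, obtained from the AM-GM inequality after a simultaneous
    diagonalisation.

  The square root requires the spectral theorem for real symmetric matrices, which is proved by
  maximising Rayleigh quotients. The volume formula for images of the ball is reduced by polar and
  spectral decomposition to diagonal maps, which stretch the coordinates, and to orthogonal maps,
  which preserve volume because a Vitali covering by balls is carried to balls of the same radii.
\<close>

section \<open>Diagonal matrices and matrix algebra\<close>

definition diag_mat :: "('n \<Rightarrow> real) \<Rightarrow> real ^ 'n ^ 'n" where
  "diag_mat d = (\<chi> i j. if i = j then d i else 0)"

lemma diag_mat_mult_vec: "diag_mat d *v x = (\<chi> k. d k * x $ k)"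
  by (simp add: diag_mat_def matrix_vector_mult_def vec_eq_iff if_distrib if_distribR cong: if_cong)

lemma diag_mat_mult: "diag_mat d ** diag_mat e = diag_mat (\<lambda>i. d i * e i)"
proof -
  have "(\<Sum>k\<in>UNIV. (if i = k then d i else 0) * (if k = j then e k else 0)) =
      (\<Sum>k\<in>UNIV. if k = i then (if i = j then d i * e i else 0) else 0)" for i j
    by (intro sum.cong) auto
  then show ?thesis by (simp add: diag_mat_def matrix_matrix_mult_def vec_eq_iff)
qed

lemma det_diag_mat: "det (diag_mat d) = prod d UNIV"
  by (subst det_diagonal) (auto simp: diag_mat_def)

lemma transpose_diag_mat [simp]: "transpose (diag_mat d) = diag_mat d"
  by (auto simp: diag_mat_def transpose_def vec_eq_iff)

lemma diag_mat_add_id: "mat 1 + diag_mat d = diag_mat (\<lambda>i. 1 + d i)"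
  by (auto simp: diag_mat_def mat_def vec_eq_iff)

lemma trace_diag_mat: "trace (diag_mat d) = sum d UNIV"
  by (simp add: diag_mat_def trace_def)

lemma matrix_add_rdistrib: "(A + B) ** C = A ** C + (B ** C :: real ^ 'n ^ 'm)"
  by (simp add: matrix_matrix_mult_def vec_eq_iff sum.distrib distrib_right)

lemma transpose_add: "transpose (A + B) = transpose A + transpose (B :: real ^ 'n ^ 'm)"
  by (simp add: transpose_def vec_eq_iff)

lemma inner_matrix_vector: "x \<bullet> (A *v y) = (transpose A *v x) \<bullet> (y :: real ^ 'n)"
  by (simp add: dot_lmul_matrix)

lemma abs_det_orthogonal_matrix:
  fixes Q :: "real ^ 'n ^ 'n"
  assumes "orthogonal_matrix Q" shows "\<bar>det Q\<bar> = 1"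
  using det_orthogonal_matrix[OF assms] by auto

section \<open>The spectral theorem for symmetric matrices\<close>

text \<open>
  The eigenvector is a maximiser \<open>v\<close> of the Rayleigh quotient on the unit sphere of \<open>S\<close>, with the maximum
  \<open>c\<close> as eigenvalue. Indeed the quadratic form \<open>q x = c (x \<bullet> x) - f x \<bullet> x\<close> is nonnegative on \<open>S\<close> and vanishes at
  \<open>v\<close>; its first variation at \<open>v\<close> in the direction of the residual \<open>u = c v - f v\<close> is \<open>2 (u \<bullet> u)\<close>, which must
  then be zero.
\<close>

lemma selfadjoint_eigenvector:
  fixes f :: "'a::euclidean_space \<Rightarrow> 'a"
  assumes lin: "linear f" and sym: "\<And>x y. f x \<bullet> y = x \<bullet> f y"
    and S: "subspace S" "S \<noteq> {0}" and inv: "\<And>x. x \<in> S \<Longrightarrow> f x \<in> S"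
  obtains v c where "v \<in> S" "norm v = 1" "f v = c *\<^sub>R v"
proof -
  let ?K = "S \<inter> sphere 0 1"
  have S0: "0 \<in> S" using S(1) by (rule subspace_0)
  obtain w where w: "w \<in> S" "w \<noteq> 0" using S S0 by auto
  have "compact ?K"
    by (intro closed_Int_compact closed_subspace S compact_sphere)
  moreover have "sgn w \<in> ?K"
    using w S(1) by (auto simp: sgn_div_norm subspace_scale)
  then have "?K \<noteq> {}" by blast
  moreover have "continuous_on ?K (\<lambda>x. f x \<bullet> x)"
    by (intro continuous_intros linear_continuous_on linear_conv_bounded_linear[THEN iffD1] lin)
  ultimately have "\<exists>v\<in>?K. \<forall>x\<in>?K. f x \<bullet> x \<le> f v \<bullet> v"
    by (rule continuous_attains_sup)
  then obtain v where v: "v \<in> ?K" and max: "\<And>x. x \<in> ?K \<Longrightarrow> f x \<bullet> x \<le> f v \<bullet> v"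
    by blast
  define c where "c = f v \<bullet> v"
  have vS: "v \<in> S" and vv: "v \<bullet> v = 1" using v by (auto simp: dot_square_norm)
  define q where "q x = c * (x \<bullet> x) - f x \<bullet> x" for x
  have q_nonneg: "q x \<ge> 0" if "x \<in> S" for x
  proof (cases "x = 0")
    case False
    have "sgn x \<in> ?K" using that False S(1) by (auto simp: sgn_div_norm subspace_scale)
    from max[OF this] have "f (sgn x) \<bullet> sgn x \<le> c" by (simp add: c_def)
    then have "(f x \<bullet> x) / (norm x)\<^sup>2 \<le> c"
      by (simp add: sgn_div_norm linear_scale[OF lin] power2_eq_square divide_simps)
    then show ?thesis using False
      by (simp add: q_def dot_square_norm divide_simps mult.commute)
  qed (simp add: q_def linear_0[OF lin])
  define u where "u = c *\<^sub>R v - f v"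
  have uS: "u \<in> S" unfolding u_def by (intro subspace_diff subspace_scale S inv vS)
  define a where "a = u \<bullet> u"
  have expand: "q (v + t *\<^sub>R u) = 2 * t * a + t\<^sup>2 * q u" for t
  proof -
    have "f u \<bullet> v = f v \<bullet> u" by (metis sym inner_commute)
    then have "q (v + t *\<^sub>R u) = 2 * t * (c * (v \<bullet> u) - f v \<bullet> u) + t\<^sup>2 * q u"
      using vv unfolding q_def
      by (simp add: linear_add[OF lin] linear_scale[OF lin] inner_add_left inner_add_right
          c_def[symmetric] inner_commute[of u v] power2_eq_square) (simp add: algebra_simps)
    moreover have "a = c * (v \<bullet> u) - f v \<bullet> u"
      by (simp add: a_def u_def inner_diff_left)
    ultimately show ?thesis by simp
  qed
  have qu: "q u \<ge> 0" by (rule q_nonneg[OF uS])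
  \<comment> \<open>A small negative multiple: adding 1 to the denominator avoids the case distinction on \<open>q u = 0\<close>.\<close>
  define t where "t = - a / (q u + 1)"
  have "0 \<le> 2 * t * a + t\<^sup>2 * q u"
    using q_nonneg[of "v + t *\<^sub>R u"] vS uS S(1) by (simp add: expand subspace_add subspace_scale)
  also have "\<dots> = - (a\<^sup>2 * (q u + 2) / (q u + 1)\<^sup>2)"
    using qu by (simp add: t_def power2_eq_square divide_simps) (simp add: algebra_simps)
  finally have "a\<^sup>2 * (q u + 2) / (q u + 1)\<^sup>2 \<le> 0" by simp
  moreover have "q u + 2 > 0" "(q u + 1)\<^sup>2 > 0" using qu by simp_all
  ultimately have "a\<^sup>2 \<le> 0"
    by (simp add: divide_le_0_iff mult_le_0_iff)
  then have "u = 0" by (simp add: a_def)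
  then have "f v = c *\<^sub>R v" by (simp add: u_def)
  moreover have "norm v = 1" using v by simp
  ultimately show thesis using vS by (intro that)
qed

text \<open>
  An orthonormal set of eigenvectors that does not yet span can be enlarged, because its orthogonal
  complement is a nonzero subspace that \<open>f\<close> leaves invariant.
\<close>

lemma selfadjoint_orthonormal_eigenbasis:
  fixes f :: "'a::euclidean_space \<Rightarrow> 'a"
  assumes lin: "linear f" and sym: "\<And>x y. f x \<bullet> y = x \<bullet> f y"
  obtains B where "pairwise orthogonal B" "\<And>b. b \<in> B \<Longrightarrow> norm b = 1"
    "\<And>b. b \<in> B \<Longrightarrow> \<exists>c. f b = c *\<^sub>R b" "finite B" "card B = DIM('a)"
proof -
  define ok where "ok B \<longleftrightarrow> pairwise orthogonal B \<and> (\<forall>b\<in>B. norm b = 1 \<and> (\<exists>c. f b = c *\<^sub>R b))"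
    for B
  have ok_indep: "independent B" if "ok B" for B
    using that pairwise_orthogonal_independent[of B] by (force simp: ok_def)
  have "\<exists>B. ok B \<and> finite B \<and> card B = k" if "k \<le> DIM('a)" for k
    using that
  proof (induction k)
    case 0
    show ?case by (intro exI[of _ "{}"]) (auto simp: ok_def)
  next
    case (Suc k)
    then obtain B where B: "ok B" "finite B" "card B = k" by auto
    define S where "S = {y. \<forall>x\<in>B. orthogonal x y}"
    have sub_S: "subspace S" unfolding S_def by (rule subspace_orthogonal_to_vectors)
    have dimB: "dim B < DIM('a)"
      using Suc.prems B ok_indep dim_eq_card_independent by fastforce
    obtain x where x: "x \<noteq> 0" "\<And>y. y \<in> span B \<Longrightarrow> orthogonal x y"
      by (rule orthogonal_to_subspace_exists[OF dimB]) (rule that)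
    have "x \<in> S"
    proof -
      have "orthogonal b x" if "b \<in> B" for b
        using x(2)[OF span_base[OF that]] by (simp only: orthogonal_commute)
      then show ?thesis by (simp add: S_def)
    qed
    then have S_nz: "S \<noteq> {0}" using x(1) by blast
    have f_S: "f y \<in> S" if "y \<in> S" for y
      unfolding S_def
    proof (clarify)
      fix b assume "b \<in> B"
      then obtain c where "f b = c *\<^sub>R b" using B(1) by (auto simp: ok_def)
      then have "b \<bullet> f y = c * (b \<bullet> y)" by (simp add: sym[symmetric])
      with that \<open>b \<in> B\<close> show "orthogonal b (f y)" by (simp add: S_def orthogonal_def)
    qed
    obtain v c where v: "v \<in> S" "norm v = 1" "f v = c *\<^sub>R v"
      by (rule selfadjoint_eigenvector[OF lin sym sub_S S_nz f_S]) (assumption, rule that)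
    have "v \<notin> B" using v by (auto simp: S_def orthogonal_def)
    then show ?case using B v
      by (intro exI[of _ "insert v B"])
        (auto simp: ok_def S_def pairwise_insert orthogonal_commute)
  qed
  from this[of "DIM('a)"] show thesis using that by (auto simp: ok_def)
qed

theorem spectral_theorem_symmetric:
  fixes A :: "real ^ 'n ^ 'n"
  assumes "transpose A = A"
  obtains Q d where "orthogonal_matrix Q" "A = Q ** diag_mat d ** transpose Q"
proof -
  have sym: "(A *v x) \<bullet> y = x \<bullet> (A *v y)" for x y
    using inner_matrix_vector[of x A y] assms by simp
  obtain B where B: "pairwise orthogonal B" "\<And>b. b \<in> B \<Longrightarrow> norm b = 1"
    "\<And>b. b \<in> B \<Longrightarrow> \<exists>c. A *v b = c *\<^sub>R b" "finite B" "card B = DIM(real ^ 'n)"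
    by (rule selfadjoint_orthonormal_eigenbasis[OF matrix_vector_mul_linear sym]) (rule that)
  obtain g where g: "bij_betw g (UNIV :: 'n set) B"
    using finite_same_card_bij[of "UNIV :: 'n set" B] B(4,5) by auto
  have gB: "g i \<in> B" for i using bij_betwE[OF g] by blast
  have "\<forall>i. \<exists>c. A *v g i = c *\<^sub>R g i" by (intro allI B(3) gB)
  from choice[OF this] obtain d where d: "\<And>i. A *v g i = d i *\<^sub>R g i"
    by blast
  define Q :: "real ^ 'n ^ 'n" where "Q = (\<chi> i j. g j $ i)"
  have col: "column i Q = g i" for i by (simp add: Q_def column_def)
  have "g i \<noteq> g j" if "i \<noteq> j" for i j
    using bij_betw_imp_inj_on[OF g] that by (simp add: inj_eq)
  then have orth: "orthogonal (g i) (g j)" if "i \<noteq> j" for i j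
    using that by (intro pairwiseD[OF B(1) gB gB])
  have Q: "orthogonal_matrix Q"
    unfolding orthogonal_matrix_orthonormal_columns col by (intro conjI allI impI B(2) gB orth)
  have "(A ** Q) $ i $ j = (Q ** diag_mat d) $ i $ j" for i j
  proof -
    have "(A ** Q) $ i $ j = (A *v g j) $ i"
      by (simp add: matrix_matrix_mult_def matrix_vector_mult_def Q_def)
    then show ?thesis
      by (simp add: d Q_def matrix_matrix_mult_def diag_mat_def if_distrib if_distribR cong: if_cong)
  qed
  then have "A ** Q = Q ** diag_mat d" by (simp add: vec_eq_iff)
  then have "Q ** diag_mat d ** transpose Q = A ** (Q ** transpose Q)"
    by (simp add: matrix_mul_assoc)
  then have "A = Q ** diag_mat d ** transpose Q"
    using Q by (simp add: orthogonal_matrix_def)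
  with Q show thesis by (rule that)
qed

lemma spectral_eigenvector:
  fixes Q :: "real ^ 'n ^ 'n"
  assumes Q: "orthogonal_matrix Q" and X: "X = Q ** diag_mat d ** transpose Q"
  shows "X *v column i Q = d i *\<^sub>R column i Q"
proof -
  have "transpose Q *v (Q *v axis i 1) = axis i 1"
    using Q by (simp only: matrix_vector_mul_assoc orthogonal_matrix_def) simp
  then have "X *v (Q *v axis i 1) = Q *v (diag_mat d *v axis i 1)"
    by (simp add: X matrix_vector_mul_assoc[symmetric] del: transpose_matrix_vector)
  also have "diag_mat d *v axis i 1 = d i *\<^sub>R axis i 1"
    by (simp add: diag_mat_mult_vec vec_eq_iff axis_def)
  finally show ?thesis by (simp add: matrix_vector_mult_scaleR matrix_vector_mult_basis)
qed

section \<open>Positive definite matrices and their square roots\<close>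

lemma posdef_sym_symmetric: "posdef_sym A \<Longrightarrow> transpose A = A"
  by (simp add: posdef_sym_def)

lemma posdef_sym_pos: "posdef_sym A \<Longrightarrow> x \<noteq> 0 \<Longrightarrow> x \<bullet> (A *v x) > 0"
  by (simp add: posdef_sym_def)

lemma posdef_sym_congruence:
  fixes P M :: "real ^ 'n ^ 'n"
  assumes P: "posdef_sym P" and M: "det M \<noteq> 0"
  shows "posdef_sym (M ** P ** transpose M)"
proof -
  have "x \<bullet> ((M ** P ** transpose M) *v x) > 0" if "x \<noteq> 0" for x
  proof -
    have "inj ((*v) (transpose M))"
      using M by (intro inj_matrix_vector_mult) (simp add: invertible_det_nz)
    then have "transpose M *v x \<noteq> 0"
      using that by (metis injD matrix_vector_mult_0_right)
    then have "(transpose M *v x) \<bullet> (P *v (transpose M *v x)) > 0"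
      by (rule posdef_sym_pos[OF P])
    then show ?thesis
      by (simp add: inner_matrix_vector[of x M] matrix_vector_mul_assoc[symmetric]
          del: transpose_matrix_vector)
  qed
  then show ?thesis
    using posdef_sym_symmetric[OF P]
    by (auto simp: posdef_sym_def matrix_transpose_mul matrix_mul_assoc)
qed

lemma posdef_sym_diag_mat: "posdef_sym (diag_mat d) \<longleftrightarrow> (\<forall>i. d i > 0)"
proof
  assume "posdef_sym (diag_mat d)"
  then have "axis i 1 \<bullet> (diag_mat d *v axis i 1) > 0" for i
    by (rule posdef_sym_pos) (simp add: axis_eq_0_iff)
  then show "\<forall>i. d i > 0" by (simp add: diag_mat_mult_vec inner_axis' )
next
  assume d: "\<forall>i. d i > 0"
  have "x \<bullet> (diag_mat d *v x) > 0" if x: "x \<noteq> 0" for x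
  proof -
    obtain k where k: "x $ k \<noteq> 0" using x by (auto simp: vec_eq_iff)
    have "x \<bullet> (diag_mat d *v x) = (\<Sum>i\<in>UNIV. d i * (x $ i)\<^sup>2)"
      by (simp add: inner_vec_def diag_mat_mult_vec power2_eq_square mult_ac)
    also have "\<dots> > 0"
      using d k by (intro sum_pos2[of _ k]) (auto simp: less_imp_le)
    finally show ?thesis .
  qed
  then show "posdef_sym (diag_mat d)" by (simp add: posdef_sym_def)
qed

lemma det_conj_orthogonal:
  fixes Q :: "real ^ 'n ^ 'n"
  assumes "orthogonal_matrix Q"
  shows "det (Q ** D ** transpose Q) = det D"
  using det_orthogonal_matrix[OF assms] by (auto simp: det_mul)

lemma posdef_sym_spectral:
  fixes A :: "real ^ 'n ^ 'n"
  assumes A: "posdef_sym A"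
  obtains Q d where "orthogonal_matrix Q" "\<forall>i. d i > 0" "A = Q ** diag_mat d ** transpose Q"
proof -
  obtain Q d where Q: "orthogonal_matrix Q" and AQ: "A = Q ** diag_mat d ** transpose Q"
    using spectral_theorem_symmetric posdef_sym_symmetric[OF A] by blast
  have "transpose Q ** A ** Q = (transpose Q ** Q) ** diag_mat d ** (transpose Q ** Q)"
    by (simp add: AQ matrix_mul_assoc)
  then have "transpose Q ** A ** Q = diag_mat d"
    using Q by (simp add: orthogonal_matrix_def)
  moreover have "posdef_sym (transpose Q ** A ** transpose (transpose Q))"
    using Q det_orthogonal_matrix[OF Q] by (intro posdef_sym_congruence A) auto
  ultimately have "\<forall>i. d i > 0"
    by (simp add: posdef_sym_diag_mat)
  with Q show thesis using AQ by (rule that)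
qed

lemma posdef_sym_det_pos:
  assumes "posdef_sym A"
  shows "det A > 0"
proof -
  obtain Q d where "orthogonal_matrix Q" "\<forall>i. d i > 0" "A = Q ** diag_mat d ** transpose Q"
    using posdef_sym_spectral[OF assms] .
  then show ?thesis by (simp add: det_conj_orthogonal det_diag_mat prod_pos)
qed

lemma posdef_sym_add:
  fixes A B :: "real ^ 'n ^ 'n"
  assumes "posdef_sym A" "posdef_sym B"
  shows "posdef_sym (A + B)"
  using assms by (auto simp: posdef_sym_def transpose_add matrix_vector_mult_add_rdistrib
      inner_add_right intro!: add_pos_pos)

lemma posdef_sym_mat_1: "posdef_sym (mat 1)"
  by (simp add: posdef_sym_def)

lemma posdef_sym_mult_transpose:
  fixes M :: "real ^ 'n ^ 'n"
  assumes "det M \<noteq> 0"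
  shows "posdef_sym (M ** transpose M)"
  using posdef_sym_congruence[OF posdef_sym_mat_1 assms] by simp

lemma posdef_sym_sqrt_exists:
  fixes P :: "real ^ 'n ^ 'n"
  assumes "posdef_sym P"
  obtains R where "posdef_sym R" "R ** R = P"
proof -
  obtain Q d where Q: "orthogonal_matrix Q" and d: "\<forall>i. d i > 0"
    and P: "P = Q ** diag_mat d ** transpose Q"
    using posdef_sym_spectral[OF assms] .
  define E where "E = diag_mat (\<lambda>i. sqrt (d i))"
  let ?R = "Q ** E ** transpose Q"
  have "posdef_sym E" using d by (simp add: E_def posdef_sym_diag_mat)
  then have R: "posdef_sym ?R"
    using det_orthogonal_matrix[OF Q] by (intro posdef_sym_congruence) auto
  have "?R ** ?R = Q ** E ** (transpose Q ** Q) ** E ** transpose Q"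
    by (simp add: matrix_mul_assoc)
  moreover have "transpose Q ** Q = mat 1"
    using Q by (simp add: orthogonal_matrix_def)
  ultimately have "?R ** ?R = Q ** (E ** E) ** transpose Q"
    by (simp add: matrix_mul_assoc[symmetric])
  moreover have "E ** E = diag_mat d"
    using d by (simp add: E_def diag_mat_mult less_imp_le)
  ultimately have "?R ** ?R = P" by (simp only: P)
  with R show thesis by (rule that)
qed

text \<open>
  If \<open>R\<^sup>2 = S\<^sup>2\<close>, the symmetric matrix \<open>X = R - S\<close> satisfies \<open>R X + X S = 0\<close>. Evaluating this quadratic form
  at an eigenvector \<open>v\<close> of \<open>X\<close> with eigenvalue \<open>d\<close> gives \<open>d (v \<bullet> R v + v \<bullet> S v) = 0\<close>, hence \<open>d = 0\<close> by positivity.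
  So all eigenvalues of \<open>X\<close> vanish.
\<close>

lemma posdef_sym_sqrt_unique:
  fixes R S :: "real ^ 'n ^ 'n"
  assumes R: "posdef_sym R" and S: "posdef_sym S" and RS: "R ** R = S ** S"
  shows "R = S"
proof -
  define X where "X = R - S"
  have R_eq: "R = X + S" by (simp add: X_def)
  have "transpose X = X"
    using posdef_sym_symmetric[OF R] posdef_sym_symmetric[OF S]
    by (simp add: R_eq transpose_add)
  then obtain Q d where Q: "orthogonal_matrix Q" and X: "X = Q ** diag_mat d ** transpose Q"
    using spectral_theorem_symmetric by blast
  \<comment> \<open>Expanding \<open>R\<^sup>2 - S\<^sup>2\<close> with noncommuting factors.\<close>
  have "R ** X + X ** S + S ** S = R ** X + R ** S"
    by (metis R_eq add.assoc matrix_add_rdistrib)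
  also have "\<dots> = S ** S"
    by (metis RS R_eq matrix_add_ldistrib)
  finally have anti: "R ** X + X ** S = 0" by simp
  have "d i = 0" for i
  proof -
    define v where "v = column i Q"
    have "norm v = 1"
      using Q by (simp add: v_def orthogonal_matrix_orthonormal_columns)
    then have v0: "v \<noteq> 0" by auto
    have Xv: "X *v v = d i *\<^sub>R v"
      unfolding v_def by (rule spectral_eigenvector[OF Q X])
    have "0 = v \<bullet> ((R ** X + X ** S) *v v)" by (simp add: anti)
    also have "\<dots> = v \<bullet> (R *v (X *v v)) + v \<bullet> (X *v (S *v v))"
      by (simp add: matrix_vector_mult_add_rdistrib inner_add_right matrix_vector_mul_assoc)
    also have "v \<bullet> (X *v (S *v v)) = (X *v v) \<bullet> (S *v v)"
      using inner_matrix_vector[of v X "S *v v"] \<open>transpose X = X\<close> by simp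
    finally have "d i * (v \<bullet> (R *v v) + v \<bullet> (S *v v)) = 0"
      by (simp add: Xv matrix_vector_mult_scaleR distrib_left)
    then show "d i = 0"
      using posdef_sym_pos[OF R v0] posdef_sym_pos[OF S v0] by simp
  qed
  then have "diag_mat d = 0" by (simp add: diag_mat_def vec_eq_iff)
  then have "X = 0" by (simp add: X matrix_matrix_mult_def vec_eq_iff)
  then show ?thesis by (simp add: X_def)
qed

lemma msqrt_square:
  assumes "posdef_sym R"
  shows "msqrt (R ** R) = R"
  unfolding msqrt_def
proof (rule the_equality)
  show "S = R" if "posdef_sym S \<and> S ** S = R ** R" for S
    using posdef_sym_sqrt_unique[of S R] that assms by blast
qed (use assms in simp)

lemma
  assumes "posdef_sym P"
  shows msqrt_posdef: "posdef_sym (msqrt P)" and msqrt_mult_self: "msqrt P ** msqrt P = P"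
proof -
  obtain R where R: "posdef_sym R" "R ** R = P"
    using posdef_sym_sqrt_exists[OF assms] .
  then have "msqrt P = R" using msqrt_square[OF R(1)] by simp
  with R show "posdef_sym (msqrt P)" "msqrt P ** msqrt P = P" by simp_all
qed

lemma det_msqrt_mult_transpose:
  fixes K :: "real ^ 'n ^ 'n"
  assumes K: "det K \<noteq> 0"
  shows "det (msqrt (K ** transpose K)) = \<bar>det K\<bar>"
proof -
  have P: "posdef_sym (K ** transpose K)" by (rule posdef_sym_mult_transpose[OF K])
  have "(det (msqrt (K ** transpose K)))\<^sup>2 = (det K)\<^sup>2"
    using arg_cong[OF msqrt_mult_self[OF P], of det] by (simp add: det_mul power2_eq_square)
  moreover have "det (msqrt (K ** transpose K)) > 0"
    by (intro posdef_sym_det_pos msqrt_posdef P)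
  ultimately show ?thesis by (simp add: power2_eq_iff abs_if) linarith
qed

section \<open>Inverses and the polar decomposition\<close>

lemma matrix_inv_inverse:
  fixes A :: "real ^ 'n ^ 'n"
  assumes "det A \<noteq> 0"
  shows "A ** matrix_inv A = mat 1" and "matrix_inv A ** A = mat 1"
proof -
  have "\<exists>B. A ** B = mat 1 \<and> B ** A = mat 1"
    using assms by (simp add: invertible_det_nz[symmetric] invertible_def)
  from someI_ex[OF this] show "A ** matrix_inv A = mat 1" "matrix_inv A ** A = mat 1"
    by (simp_all add: matrix_inv_def)
qed

lemma transpose_matrix_inv:
  fixes A :: "real ^ 'n ^ 'n"
  assumes "transpose A = A" and A: "det A \<noteq> 0"
  shows "transpose (matrix_inv A) = matrix_inv A"
proof -
  have "A ** transpose (matrix_inv A) = mat 1"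
    using arg_cong[OF matrix_inv_inverse(2)[OF A], of transpose] assms(1)
    by (simp add: matrix_transpose_mul)
  then have "matrix_inv A ** (A ** transpose (matrix_inv A)) = matrix_inv A" by simp
  then show ?thesis by (simp add: matrix_mul_assoc matrix_inv_inverse(2)[OF A])
qed

lemma det_matrix_inv:
  fixes A :: "real ^ 'n ^ 'n"
  assumes "det A \<noteq> 0"
  shows "det (matrix_inv A) = 1 / det A"
  using arg_cong[OF matrix_inv_inverse(1)[OF assms], of det] assms
  by (simp add: det_mul field_simps)

text \<open>
  With \<open>R\<close> the root of \<open>M M\<^sup>T\<close>, the factor \<open>U = R\<^sup>-\<^sup>1 M\<close> is forced, and it is orthogonal because
  \<open>U U\<^sup>T = R\<^sup>-\<^sup>1 R\<^sup>2 R\<^sup>-\<^sup>1\<close>.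
\<close>

lemma polar_decomposition:
  fixes M :: "real ^ 'n ^ 'n"
  assumes M: "det M \<noteq> 0"
  obtains U where "orthogonal_matrix U" "M = msqrt (M ** transpose M) ** U"
proof -
  define R where "R = msqrt (M ** transpose M)"
  have R: "posdef_sym R" and RR: "R ** R = M ** transpose M"
    unfolding R_def using posdef_sym_mult_transpose[OF M] msqrt_posdef msqrt_mult_self by blast+
  have detR: "det R \<noteq> 0" using posdef_sym_det_pos[OF R] by simp
  note inv = matrix_inv_inverse[OF detR]
  define U where "U = matrix_inv R ** M"
  have "transpose (matrix_inv R) = matrix_inv R"
    by (intro transpose_matrix_inv posdef_sym_symmetric R detR)
  then have "U ** transpose U = matrix_inv R ** (M ** transpose M) ** matrix_inv R"
    by (simp add: U_def matrix_transpose_mul matrix_mul_assoc)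
  also have "\<dots> = (matrix_inv R ** R) ** (R ** matrix_inv R)"
    by (simp only: RR[symmetric] matrix_mul_assoc)
  finally have "orthogonal_matrix (transpose U)"
    by (simp add: inv orthogonal_matrix)
  moreover have "M = R ** U"
    by (simp add: U_def matrix_mul_assoc inv)
  ultimately show thesis by (intro that) (simp_all add: R_def)
qed

section \<open>Determinant inequalities\<close>

text \<open>
  Hadamard's inequality with normalised rows. The Gram matrix \<open>M M\<^sup>T\<close> has nonnegative eigenvalues whose
  sum, the trace, is the sum of the squared row norms. By AM-GM their product, which is \<open>(det M)\<^sup>2\<close>,
  is at most 1.
\<close>

lemma abs_det_le_1_if_rows_le_1:
  fixes M :: "real ^ 'n ^ 'n"
  assumes rows: "\<And>i. norm (row i M) \<le> 1"
  shows "\<bar>det M\<bar> \<le> 1"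
proof -
  let ?n = "real CARD('n)"
  define S where "S = M ** transpose M"
  have "transpose S = S" by (simp add: S_def matrix_transpose_mul)
  then obtain Q d where Q: "orthogonal_matrix Q" and S: "S = Q ** diag_mat d ** transpose Q"
    using spectral_theorem_symmetric by blast
  have d_nonneg: "d i \<ge> 0" for i
  proof -
    have "column i Q \<bullet> column i Q = 1"
      using Q by (simp add: orthogonal_matrix_orthonormal_columns norm_eq_1)
    then have "d i = column i Q \<bullet> (S *v column i Q)"
      by (simp add: spectral_eigenvector[OF Q S])
    also have "\<dots> = (transpose M *v column i Q) \<bullet> (transpose M *v column i Q)"
      by (simp add: S_def inner_matrix_vector[of _ M] matrix_vector_mul_assoc[symmetric]
          del: transpose_matrix_vector)
    finally show ?thesis by simp
  qed
  have "sum d UNIV = trace (diag_mat d ** (transpose Q ** Q))"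
    using Q by (simp add: trace_diag_mat orthogonal_matrix_def)
  also have "\<dots> = trace S"
    by (simp add: S matrix_mul_assoc) (metis matrix_mul_assoc trace_mul_sym)
  also have "\<dots> = (\<Sum>i\<in>UNIV. (norm (row i M))\<^sup>2)"
    by (simp add: S_def trace_def matrix_matrix_mult_def transpose_def row_def
        power2_norm_eq_inner inner_vec_def)
  also have "\<dots> \<le> (\<Sum>i\<in>(UNIV::'n set). 1)"
    using rows by (intro sum_mono) (simp add: power_le_one)
  finally have "sum d UNIV \<le> ?n" by simp
  then have "(\<Sum>i\<in>UNIV. d i / card (UNIV :: 'n set)) \<le> 1"
    by (simp add: sum_divide_distrib[symmetric])
  moreover have "(\<Prod>i\<in>UNIV. d i) powr (1 / card (UNIV :: 'n set))
      \<le> (\<Sum>i\<in>UNIV. d i / card (UNIV :: 'n set))"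
    by (rule arith_geom_mean) (auto simp: d_nonneg)
  ultimately have "prod d UNIV powr (1 / ?n) \<le> 1" by simp
  then have "(prod d UNIV powr (1 / ?n)) powr ?n \<le> 1"
    by (intro powr_le1) auto
  then have "prod d UNIV \<le> 1"
    by (simp add: powr_powr d_nonneg prod_nonneg)
  moreover have "prod d UNIV = (det M)\<^sup>2"
    using det_conj_orthogonal[OF Q, of "diag_mat d"] S[symmetric]
    by (simp add: det_diag_mat S_def det_mul power2_eq_square)
  ultimately show ?thesis by (simp add: abs_square_le_1)
qed

text \<open>
  In an eigenbasis of \<open>G\<close> with eigenvalues \<open>d i\<close> the orthogonal matrix \<open>U\<close> still has unit rows, so the \<open>i\<close>-th row of
  the sum has norm at most \<open>1 + d i\<close>. Dividing it by that number reduces the claim to Hadamard's inequality.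
\<close>

lemma det_posdef_add_orthogonal_le:
  fixes G U :: "real ^ 'n ^ 'n"
  assumes G: "posdef_sym G" and U: "orthogonal_matrix U"
  shows "\<bar>det (G + U)\<bar> \<le> det (mat 1 + G)"
proof -
  obtain Q d where Q: "orthogonal_matrix Q" and d: "\<forall>i. d i > 0"
    and GQ: "G = Q ** diag_mat d ** transpose Q"
    using posdef_sym_spectral[OF G] .
  have QQ: "Q ** transpose Q = mat 1" using Q by (simp add: orthogonal_matrix_def)
  define W where "W = transpose Q ** U ** Q"
  have W: "orthogonal_matrix W"
    unfolding W_def using Q U by (intro orthogonal_matrix_mul) auto
  have "Q ** W ** transpose Q = (Q ** transpose Q) ** U ** (Q ** transpose Q)"
    by (simp add: W_def matrix_mul_assoc)
  then have "Q ** W ** transpose Q = U" by (simp add: QQ)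
  then have "G + U = Q ** (diag_mat d + W) ** transpose Q"
    by (simp add: GQ matrix_add_ldistrib matrix_add_rdistrib)
  then have det_GU: "det (G + U) = det (diag_mat d + W)"
    by (simp add: det_conj_orthogonal[OF Q])
  have "mat 1 + G = Q ** (mat 1 + diag_mat d) ** transpose Q"
    by (simp add: GQ matrix_add_ldistrib matrix_add_rdistrib QQ)
  then have det_1G: "det (mat 1 + G) = (\<Prod>i\<in>UNIV. 1 + d i)"
    by (simp add: det_conj_orthogonal[OF Q] diag_mat_add_id det_diag_mat)
  define N where "N = diag_mat (\<lambda>i. 1 / (1 + d i)) ** (diag_mat d + W)"
  have "norm (row i N) \<le> 1" for i
  proof -
    have di: "d i > 0" using d by simp
    have "(\<Sum>k\<in>UNIV. (if i = k then 1 / (1 + d i) else 0) * ((if k = j then d k else 0) + W $ k $ j))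
        = (\<Sum>k\<in>UNIV. if k = i then 1 / (1 + d i) * ((if i = j then d i else 0) + W $ i $ j) else 0)" for j
      by (intro sum.cong) auto
    then have "row i N = (1 / (1 + d i)) *\<^sub>R (d i *\<^sub>R axis i 1 + row i W)"
      by (simp add: N_def matrix_matrix_mult_def diag_mat_def row_def vec_eq_iff axis_def)
    then have "norm (row i N) = norm (d i *\<^sub>R axis i 1 + row i W) / (1 + d i)"
      using di by simp
    also have "norm (d i *\<^sub>R axis i 1 + row i W) \<le> d i + 1"
      using W di norm_triangle_ineq[of "d i *\<^sub>R axis i 1" "row i W"]
      by (simp add: orthogonal_matrix_orthonormal_rows)
    finally show ?thesis using di by (simp add: add.commute divide_right_mono)
  qed
  then have "\<bar>det N\<bar> \<le> 1" by (rule abs_det_le_1_if_rows_le_1)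
  moreover have "det N = det (diag_mat d + W) / (\<Prod>i\<in>UNIV. 1 + d i)"
    by (simp add: N_def det_mul det_diag_mat prod_dividef)
  moreover have "(\<Prod>i\<in>UNIV. 1 + d i) > 0"
    using d by (intro prod_pos) (auto simp: add_pos_pos)
  ultimately show ?thesis by (simp add: det_GU det_1G divide_simps)
qed

text \<open>
  Superadditivity of the geometric mean: divide by the right-hand side and apply AM-GM separately to the
  numbers \<open>1 / (1 + d i)\<close> and \<open>d i / (1 + d i)\<close>, whose arithmetic means add up to 1.
\<close>

lemma prod_powr_superadditive:
  fixes d :: "'n::finite \<Rightarrow> real"
  assumes d: "\<And>i. d i \<ge> 0"
  shows "1 + prod d UNIV powr (1 / CARD('n)) \<le> (\<Prod>i\<in>UNIV. 1 + d i) powr (1 / CARD('n))"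
proof -
  define n where "n = real CARD('n)"
  have n: "n > 0" by (simp add: n_def)
  define p where "p = (\<Prod>i\<in>UNIV. 1 + d i)"
  have pos: "1 + d i > 0" for i using d[of i] by linarith
  then have p: "p > 0" by (auto simp: p_def intro: prod_pos)
  have "(\<Prod>i\<in>UNIV. 1 / (1 + d i)) powr (1 / n) \<le> (\<Sum>i\<in>UNIV. 1 / (1 + d i) / n)"
    "(\<Prod>i\<in>UNIV. d i / (1 + d i)) powr (1 / n) \<le> (\<Sum>i\<in>UNIV. d i / (1 + d i) / n)"
    unfolding n_def using d pos by (intro arith_geom_mean; auto simp: less_imp_le)+
  moreover have "(\<Sum>i\<in>UNIV. 1 / (1 + d i) / n) + (\<Sum>i\<in>UNIV. d i / (1 + d i) / n) = 1"
  proof -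
    have "1 / (1 + d i) / n + d i / (1 + d i) / n = 1 / n" for i
      using pos[of i] n by (simp add: add_divide_distrib[symmetric])
    then show ?thesis using n by (simp add: sum.distrib[symmetric] n_def)
  qed
  ultimately have "(1 / p) powr (1 / n) + (prod d UNIV / p) powr (1 / n) \<le> 1"
    by (simp add: prod_dividef p_def)
  then have "(1 + prod d UNIV powr (1 / n)) / p powr (1 / n) \<le> 1"
    using p d by (simp add: powr_divide prod_nonneg add_divide_distrib)
  then have "1 + prod d UNIV powr (1 / n) \<le> p powr (1 / n)"
    using p by simp
  then show ?thesis by (simp add: p_def n_def)
qed

text \<open>
  A congruence by the inverse square root of \<open>A\<close> turns \<open>A\<close> into the identity, and an orthogonal change of basis
  then makes \<open>B\<close> diagonal. This reduces the claim to superadditivity of the geometric mean.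
\<close>

theorem minkowski_determinant:
  fixes A B :: "real ^ 'n ^ 'n"
  assumes A: "posdef_sym A" and B: "posdef_sym B"
  shows "det A powr (1 / CARD('n)) + det B powr (1 / CARD('n)) \<le> det (A + B) powr (1 / CARD('n))"
proof -
  define R where "R = msqrt A"
  have R: "posdef_sym R" and RR: "R ** R = A"
    unfolding R_def using msqrt_posdef[OF A] msqrt_mult_self[OF A] by auto
  have detR: "det R \<noteq> 0" using posdef_sym_det_pos[OF R] by simp
  note inv = matrix_inv_inverse[OF detR]
  have inv_sym: "transpose (matrix_inv R) = matrix_inv R"
    by (intro transpose_matrix_inv posdef_sym_symmetric R detR)
  define S where "S = matrix_inv R ** B ** matrix_inv R"
  have "posdef_sym S"
    using posdef_sym_congruence[OF B, of "matrix_inv R"] detR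
    by (simp add: S_def inv_sym det_matrix_inv)
  then obtain Q d where Q: "orthogonal_matrix Q" and d: "\<forall>i. d i > 0"
    and SQ: "S = Q ** diag_mat d ** transpose Q"
    by (rule posdef_sym_spectral)
  have QQ: "Q ** transpose Q = mat 1" using Q by (simp add: orthogonal_matrix_def)
  have "R ** S ** R = (R ** matrix_inv R) ** B ** (matrix_inv R ** R)"
    by (simp only: S_def matrix_mul_assoc)
  then have RSR: "R ** S ** R = B" by (simp add: inv)
  have det_A: "det A = (det R)\<^sup>2" by (simp add: RR[symmetric] det_mul power2_eq_square)
  have "det S = prod d UNIV"
    by (simp only: SQ det_conj_orthogonal[OF Q] det_diag_mat)
  then have det_B: "det B = (det R)\<^sup>2 * prod d UNIV"
    by (simp add: RSR[symmetric] det_mul power2_eq_square)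
  have "A + B = R ** (mat 1 + S) ** R"
    by (simp add: matrix_add_ldistrib matrix_add_rdistrib RR RSR)
  moreover have "mat 1 + S = Q ** (mat 1 + diag_mat d) ** transpose Q"
    by (simp add: SQ matrix_add_ldistrib matrix_add_rdistrib QQ)
  then have "det (mat 1 + S) = (\<Prod>i\<in>UNIV. 1 + d i)"
    by (simp add: det_conj_orthogonal[OF Q] diag_mat_add_id det_diag_mat)
  ultimately have det_AB: "det (A + B) = (det R)\<^sup>2 * (\<Prod>i\<in>UNIV. 1 + d i)"
    by (simp add: det_mul power2_eq_square)
  let ?r = "(det R)\<^sup>2 powr (1 / CARD('n))"
  have "?r * (1 + prod d UNIV powr (1 / CARD('n))) \<le> ?r * (\<Prod>i\<in>UNIV. 1 + d i) powr (1 / CARD('n))"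
    using d by (intro mult_left_mono prod_powr_superadditive) (auto simp: less_imp_le)
  moreover have "prod d UNIV \<ge> 0" "(\<Prod>i\<in>UNIV. 1 + d i) \<ge> 0"
    using d by (auto intro!: prod_nonneg simp: less_imp_le add_nonneg_nonneg)
  ultimately show ?thesis
    by (simp add: det_A det_B det_AB powr_mult distrib_left)
qed

section \<open>Volumes of ellipsoids\<close>

text \<open>
  By Vitali's theorem an open set is, up to a null set, a countable disjoint union of balls. An orthogonal
  map carries them to disjoint balls of the same radii inside the image, whose measures add up to that
  of the set.
\<close>

lemma emeasure_orthogonal_image_ge:
  fixes f :: "'a::euclidean_space \<Rightarrow> 'a"
  assumes f: "orthogonal_transformation f" and S: "open S"
  shows "emeasure lebesgue S \<le> emeasure lebesgue (f ` S)"
proof -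
  define K where "K = {(x, r). 0 < r \<and> ball x r \<subseteq> S}"
  have "\<exists>i. i \<in> K \<and> x \<in> ball (fst i) (snd i) \<and> snd i < e" if xe: "x \<in> S" "0 < e" for x e
  proof -
    obtain k where k: "k > 0" "ball x k \<subseteq> S" using S xe(1) openE by blast
    have "ball x (min k (e / 2)) \<subseteq> S" using k(2) by auto
    then show ?thesis
      using k(1) xe(2) by (intro exI[of _ "(x, min k (e / 2))"]) (auto simp: K_def)
  qed
  then obtain C where C: "countable C" "C \<subseteq> K"
    and disj: "pairwise (\<lambda>i j. disjnt (ball (fst i) (snd i)) (ball (fst j) (snd j))) C"
    and neg: "negligible (S - (\<Union>i\<in>C. ball (fst i) (snd i)))"
    by (rule Vitali_covering_theorem_balls)
  define X where "X i = ball (fst i) (snd i)" for i :: "'a \<times> real"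
  have XS: "X i \<subseteq> S" if "i \<in> C" for i
    using subsetD[OF C(2) that] by (simp add: K_def X_def split_beta)
  have fX: "f ` X i = ball (f (fst i)) (snd i)" for i
    unfolding X_def using f by (rule image_orthogonal_transformation_ball)
  have same: "emeasure lebesgue (f ` X i) = emeasure lebesgue (X i)" if "i \<in> C" for i
    using C(2) that unfolding fX unfolding X_def
    by (auto simp: K_def emeasure_ball)
  have inj: "inj f" by (rule orthogonal_transformation_inj[OF f])
  have dX: "disjoint_family_on X C"
    using disj by (auto simp: disjoint_family_on_def pairwise_def disjnt_def X_def)
  have dfX: "disjoint_family_on (\<lambda>i. f ` X i) C"
    unfolding disjoint_family_on_def
  proof (intro ballI impI)
    fix i j assume "i \<in> C" "j \<in> C" "i \<noteq> j"
    then have "X i \<inter> X j = {}" using dX by (auto simp: disjoint_family_on_def)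
    then show "f ` X i \<inter> f ` X j = {}" by (simp add: image_Int[OF inj, symmetric])
  qed
  have null: "S - (\<Union>i\<in>C. X i) \<in> null_sets lebesgue"
    using neg by (simp add: negligible_iff_null_sets X_def)
  have UX: "(\<Union>i\<in>C. X i) \<in> sets lebesgue"
    by (simp add: X_def open_UN)
  have "emeasure lebesgue S \<le> emeasure lebesgue ((\<Union>i\<in>C. X i) \<union> (S - (\<Union>i\<in>C. X i)))"
    using null_setsD2[OF null] UX by (intro emeasure_mono sets.Un) blast
  also have "\<dots> = emeasure lebesgue (\<Union>i\<in>C. X i)"
    by (rule emeasure_Un_null_set[OF UX null])
  also have "\<dots> = (\<integral>\<^sup>+i. emeasure lebesgue (X i) \<partial>count_space C)"
    by (intro emeasure_UN_countable C(1) dX) (auto simp: X_def)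
  also have "\<dots> = (\<integral>\<^sup>+i. emeasure lebesgue (f ` X i) \<partial>count_space C)"
    by (intro nn_integral_cong) (simp add: same)
  also have "\<dots> = emeasure lebesgue (\<Union>i\<in>C. f ` X i)"
    by (intro emeasure_UN_countable[symmetric] C(1) dfX) (auto simp: fX)
  also have "\<dots> \<le> emeasure lebesgue (f ` S)"
  proof (rule emeasure_mono)
    show "(\<Union>i\<in>C. f ` X i) \<subseteq> f ` S" using XS by blast
    have "open (f ` S)"
      using orthogonal_transformation_linear[OF f] orthogonal_transformation_surj[OF f] S
      by (intro open_surjective_linear_image)
    then show "f ` S \<in> sets lebesgue" by simp
  qed
  finally show ?thesis .
qed

lemma measure_orthogonal_image_open:
  fixes f :: "'a::euclidean_space \<Rightarrow> 'a"
  assumes f: "orthogonal_transformation f" and S: "open S"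
  shows "measure lebesgue (f ` S) = measure lebesgue S"
proof -
  have lin: "linear f" and surj: "surj f" and inj: "inj f"
    using f by (auto simp: orthogonal_transformation_linear orthogonal_transformation_surj
        orthogonal_transformation_inj)
  have "open (f ` S)" using S lin surj by (intro open_surjective_linear_image)
  then have "emeasure lebesgue (f ` S) \<le> emeasure lebesgue (inv f ` f ` S)"
    using orthogonal_transformation_inv[OF f] by (intro emeasure_orthogonal_image_ge)
  also have "inv f ` f ` S = S" using inj by (simp add: image_comp)
  finally show ?thesis
    using emeasure_orthogonal_image_ge[OF f S] by (simp add: measure_def antisym)
qed

lemma orthogonal_matrix_transformation:
  fixes Q :: "real ^ 'n ^ 'n"
  assumes "orthogonal_matrix Q"
  shows "orthogonal_transformation ((*v) Q)"
  using assms by (simp add: orthogonal_transformation_matrix matrix_of_matrix_vector_mul)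

lemma orthogonal_matrix_image_ball_0:
  fixes Q :: "real ^ 'n ^ 'n"
  assumes "orthogonal_matrix Q"
  shows "(*v) Q ` ball 0 r = ball 0 r"
  using image_orthogonal_transformation_ball[OF orthogonal_matrix_transformation[OF assms], of 0 r]
  by simp

lemma open_matrix_image:
  fixes M :: "real ^ 'n ^ 'n"
  assumes "det M \<noteq> 0" and S: "open S"
  shows "open ((*v) M ` S)"
proof -
  have "surj ((*v) M)"
    using assms(1) invertible_eq_bij[of M] by (simp add: invertible_det_nz bij_is_surj)
  then show ?thesis
    using S by (intro open_surjective_linear_image matrix_vector_mul_linear)
qed

text \<open>
  The polar and spectral decompositions write \<open>M\<close> as \<open>Q D Q\<^sup>T U\<close> with \<open>Q\<close> and \<open>U\<close> orthogonal and \<open>D\<close> diagonal.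
  The factors \<open>Q\<^sup>T\<close> and \<open>U\<close> fix the ball, \<open>D\<close> scales its volume by its determinant, and \<open>Q\<close> preserves the volume.
\<close>

lemma measure_matrix_image_unit_ball:
  fixes M :: "real ^ 'n ^ 'n"
  assumes M: "det M \<noteq> 0"
  shows "measure lebesgue ((*v) M ` ball 0 1) = \<bar>det M\<bar> * measure lebesgue (ball 0 1 :: (real ^ 'n) set)"
proof -
  define R where "R = msqrt (M ** transpose M)"
  obtain U where U: "orthogonal_matrix U" and MRU: "M = R ** U"
    using polar_decomposition[OF M] unfolding R_def .
  have "posdef_sym R"
    unfolding R_def by (intro msqrt_posdef posdef_sym_mult_transpose M)
  then obtain Q d where Q: "orthogonal_matrix Q" and d: "\<forall>i. d i > 0"
    and RQ: "R = Q ** diag_mat d ** transpose Q"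
    by (rule posdef_sym_spectral)
  have "det R = prod d UNIV"
    by (simp only: RQ det_conj_orthogonal[OF Q] det_diag_mat)
  then have det_M: "\<bar>det M\<bar> = \<bar>prod d UNIV\<bar>"
    by (simp add: MRU det_mul abs_mult abs_det_orthogonal_matrix[OF U])
  have det_D: "det (diag_mat d) \<noteq> 0"
    using d by (simp add: det_diag_mat less_imp_neq[symmetric])
  have "(*v) M ` ball 0 1 = (*v) Q ` (*v) (diag_mat d) ` (*v) (transpose Q) ` (*v) U ` ball 0 1"
    by (simp add: MRU RQ image_image matrix_vector_mul_assoc matrix_mul_assoc
        del: transpose_matrix_vector)
  also have "\<dots> = (*v) Q ` (*v) (diag_mat d) ` ball 0 1"
    using Q by (simp only: orthogonal_matrix_image_ball_0 U orthogonal_matrix_transpose)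
  also have "measure lebesgue \<dots> = measure lebesgue ((*v) (diag_mat d) ` ball 0 1)"
    by (intro measure_orthogonal_image_open orthogonal_matrix_transformation Q
        open_matrix_image det_D open_ball)
  also have "\<dots> = \<bar>prod d UNIV\<bar> * measure lebesgue (ball 0 1 :: (real ^ 'n) set)"
    unfolding diag_mat_mult_vec by (intro measure_stretch lmeasurable_ball)
  finally show ?thesis by (simp add: det_M)
qed

lemma open_bounded_sumset_lmeasurable:
  fixes S T :: "'a::euclidean_space set"
  assumes "open S" "bounded S" "bounded T"
  shows "{x + y | x y. x \<in> S \<and> y \<in> T} \<in> lmeasurable"
proof -
  have "{x + y | x y. x \<in> S \<and> y \<in> T} = (\<Union>x\<in>S. \<Union>y\<in>T. {x + y})" by blast
  then show ?thesis
    using open_sums[of S T] bounded_sums[of S T] assms by (simp add: lmeasurable_open)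
qed

section \<open>The geometric mean and the chain of inequalities\<close>

text \<open>
  This is the polar decomposition of \<open>M = A\<^sup>-\<^sup>1 B\<close>: since \<open>M M\<^sup>T = A\<^sup>-\<^sup>1 B\<^sup>2 A\<^sup>-\<^sup>1\<close>, its positive factor is
  the middle factor of the geometric mean of \<open>A\<^sup>2\<close> and \<open>B\<^sup>2\<close>.
\<close>

lemma posdef_relative_polar:
  fixes A B :: "real ^ 'n ^ 'n"
  assumes A: "posdef_sym A" and B: "posdef_sym B"
  obtains G U where "posdef_sym G" "orthogonal_matrix U" "B = A ** G ** U"
    "geometric_mean (A ** A) (B ** B) = A ** G ** A"
proof -
  have detA: "det A \<noteq> 0" and detB: "det B \<noteq> 0"
    using posdef_sym_det_pos[OF A] posdef_sym_det_pos[OF B] by simp_all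
  note symA = posdef_sym_symmetric[OF A] and symB = posdef_sym_symmetric[OF B]
  define M where "M = matrix_inv A ** B"
  define G where "G = msqrt (M ** transpose M)"
  have M: "det M \<noteq> 0" using detA detB by (simp add: M_def det_mul det_matrix_inv)
  obtain U where U: "orthogonal_matrix U" and MGU: "M = G ** U"
    using polar_decomposition[OF M] unfolding G_def .
  have "posdef_sym G"
    unfolding G_def by (intro msqrt_posdef posdef_sym_mult_transpose M)
  moreover have "A ** M = B"
    by (simp add: M_def matrix_mul_assoc matrix_inv_inverse[OF detA])
  then have "B = A ** G ** U" by (simp add: MGU matrix_mul_assoc)
  moreover have "M ** transpose M = matrix_inv A ** (B ** B) ** matrix_inv A"
    by (simp add: M_def matrix_transpose_mul matrix_mul_assoc symB transpose_matrix_inv[OF symA detA])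
  then have "geometric_mean (A ** A) (B ** B) = A ** G ** A"
    by (simp add: geometric_mean_def msqrt_square[OF A] G_def)
  ultimately show thesis using U by (intro that)
qed

text \<open>
  The orthogonal factor cancels in \<open>B\<^sup>2 = B B\<^sup>T = A G\<^sup>2 A\<close>, so the matrix under the root is the perfect square
  \<open>A (I + 2 G + G\<^sup>2) A\<close>.
\<close>

lemma F_eq_msqrt:
  fixes A B G U :: "real ^ 'n ^ 'n"
  assumes A: "posdef_sym A" and B: "posdef_sym B" and G: "posdef_sym G"
    and U: "orthogonal_matrix U" and BGU: "B = A ** G ** U"
    and mean: "geometric_mean (A ** A) (B ** B) = A ** G ** A"
  defines "K \<equiv> A ** (mat 1 + G)"
  shows "F A B = msqrt (K ** transpose K)"
proof -
  note symA = posdef_sym_symmetric[OF A] and symB = posdef_sym_symmetric[OF B]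
    and symG = posdef_sym_symmetric[OF G]
  have "B ** B = B ** transpose B" by (simp add: symB)
  also have "\<dots> = A ** G ** (U ** transpose U) ** G ** A"
    by (simp add: BGU matrix_transpose_mul symA symG matrix_mul_assoc)
  also have "\<dots> = A ** G ** G ** A"
    using U by (simp add: orthogonal_matrix_def)
  finally have BB: "B ** B = A ** G ** G ** A" .
  have "K ** transpose K = A ** A + (A ** G ** A + A ** G ** A) + A ** G ** G ** A"
    by (simp add: K_def matrix_transpose_mul transpose_add symA symG
        matrix_add_ldistrib matrix_add_rdistrib matrix_mul_assoc add_ac)
  then show ?thesis
    unfolding F_def mean unfolding BB by (simp add: scaleR_2)
qed

theorem theorem5p10:
  fixes A1 A2 :: "real ^ 'n ^ 'n"
    and E1 E2 :: "(real ^ 'n) set"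
  assumes "posdef_sym A1" and "posdef_sym A2"
    and "E1 = (\<lambda>v. A1 *v v) ` ball 0 1"
    and "E2 = (\<lambda>v. A2 *v v) ` ball 0 1"
  shows "measure lebesgue {x + y | x y. x \<in> E1 \<and> y \<in> E2} powr (1 / real CARD('n))
           \<ge> measure lebesgue (ball 0 1 :: (real ^ 'n) set) powr (1 / real CARD('n))
               * det (F A1 A2) powr (1 / real CARD('n))
       \<and> measure lebesgue (ball 0 1 :: (real ^ 'n) set) powr (1 / real CARD('n))
               * det (F A1 A2) powr (1 / real CARD('n))
           \<ge> measure lebesgue (ball 0 1 :: (real ^ 'n) set) powr (1 / real CARD('n))
               * det (A1 + A2) powr (1 / real CARD('n))
       \<and> measure lebesgue (ball 0 1 :: (real ^ 'n) set) powr (1 / real CARD('n))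
               * det (A1 + A2) powr (1 / real CARD('n))
           \<ge> measure lebesgue E1 powr (1 / real CARD('n))
             + measure lebesgue E2 powr (1 / real CARD('n))"
proof -
  note A1 = assms(1) and A2 = assms(2) and E1 = assms(3) and E2 = assms(4)
  have det1: "det A1 > 0" and det2: "det A2 > 0"
    using A1 A2 by (auto intro: posdef_sym_det_pos)
  let ?v = "measure lebesgue (ball 0 1 :: (real ^ 'n) set)"
  let ?p = "1 / real CARD('n)"
  obtain G U where G: "posdef_sym G" and U: "orthogonal_matrix U"
    and A2_eq: "A2 = A1 ** G ** U"
    and mean: "geometric_mean (A1 ** A1) (A2 ** A2) = A1 ** G ** A1"
    using posdef_relative_polar[OF A1 A2] .
  have UU: "U ** transpose U = mat 1" "transpose U ** U = mat 1"
    using U by (auto simp: orthogonal_matrix_def)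
  define K where "K = A1 ** (mat 1 + G)"
  have det_K: "det K = det A1 * det (mat 1 + G)" by (simp add: K_def det_mul)
  then have K_pos: "det K > 0"
    using det1 posdef_sym_det_pos[OF posdef_sym_add[OF posdef_sym_mat_1 G]] by simp
  have det_F: "det (F A1 A2) = det K"
    unfolding F_eq_msqrt[OF A1 A2 G U A2_eq mean] K_def[symmetric]
    using K_pos by (simp add: det_msqrt_mult_transpose)

  \<comment> \<open>As \<open>A2 U\<^sup>T = A1 G\<close>, the point \<open>K v\<close> splits as \<open>A1 v + A2 (U\<^sup>T v)\<close>, and \<open>U\<^sup>T v\<close> is again in the ball.\<close>
  have "(*v) K ` ball 0 1 \<subseteq> {x + y | x y. x \<in> E1 \<and> y \<in> E2}"
  proof (rule image_subsetI)
    fix v :: "real ^ 'n" assume v: "v \<in> ball 0 1"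
    define w where "w = transpose U *v v"
    have "w \<in> ball 0 1"
      using imageI[OF v, of "(*v) (transpose U)"] U
      unfolding w_def by (simp only: orthogonal_matrix_image_ball_0 orthogonal_matrix_transpose)
    moreover have "A2 ** transpose U = A1 ** G"
      by (simp add: A2_eq UU matrix_mul_assoc[symmetric])
    then have "K *v v = A1 *v v + A2 *v w"
      by (simp add: K_def w_def matrix_vector_mul_assoc matrix_add_ldistrib
          matrix_vector_mult_add_rdistrib del: transpose_matrix_vector)
    ultimately show "K *v v \<in> {x + y | x y. x \<in> E1 \<and> y \<in> E2}"
      unfolding E1 E2 using v by blast
  qed
  moreover have "{x + y | x y. x \<in> E1 \<and> y \<in> E2} \<in> lmeasurable"
  proof (rule open_bounded_sumset_lmeasurable)
    show "open E1" unfolding E1 using det1 by (intro open_matrix_image open_ball) simp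
    show "bounded E1" "bounded E2" unfolding E1 E2
      by (intro bounded_linear_image bounded_ball matrix_vector_mul_bounded_linear)+
  qed
  moreover have "(*v) K ` ball 0 1 \<in> sets lebesgue"
    using open_matrix_image[of K "ball 0 1"] K_pos by simp
  ultimately have "measure lebesgue ((*v) K ` ball 0 1)
      \<le> measure lebesgue {x + y | x y. x \<in> E1 \<and> y \<in> E2}"
    by (intro measure_mono_fmeasurable)
  then have vol: "?v * det K \<le> measure lebesgue {x + y | x y. x \<in> E1 \<and> y \<in> E2}"
    using K_pos by (simp add: measure_matrix_image_unit_ball mult.commute)

  have "A1 + A2 = A1 ** (G + transpose U) ** U"
    by (simp add: A2_eq matrix_add_ldistrib matrix_add_rdistrib UU matrix_mul_assoc[symmetric])
  then have "\<bar>det (A1 + A2)\<bar> = det A1 * \<bar>det (G + transpose U)\<bar>"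
    using det1 by (simp add: det_mul abs_mult abs_det_orthogonal_matrix[OF U])
  also have "\<dots> \<le> det K"
    unfolding det_K using det1 G U by (intro mult_left_mono det_posdef_add_orthogonal_le) auto
  finally have det_le: "\<bar>det (A1 + A2)\<bar> \<le> det K" .

  have "posdef_sym (A1 + A2)" by (rule posdef_sym_add[OF A1 A2])
  then have det_sum: "det (A1 + A2) > 0" by (rule posdef_sym_det_pos)
  have "(?v * det K) powr ?p \<le> measure lebesgue {x + y | x y. x \<in> E1 \<and> y \<in> E2} powr ?p"
    using vol K_pos by (intro powr_mono2) auto
  moreover have "(?v * det K) powr ?p = ?v powr ?p * det K powr ?p"
    using K_pos by (simp add: powr_mult)
  moreover have "?v powr ?p * det (A1 + A2) powr ?p \<le> ?v powr ?p * det K powr ?p"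
    using det_le det_sum by (intro mult_left_mono powr_mono2) auto
  moreover have "?v powr ?p * (det A1 powr ?p + det A2 powr ?p) \<le> ?v powr ?p * det (A1 + A2) powr ?p"
    by (intro mult_left_mono minkowski_determinant A1 A2) simp
  moreover have "measure lebesgue E1 powr ?p = ?v powr ?p * det A1 powr ?p"
    "measure lebesgue E2 powr ?p = ?v powr ?p * det A2 powr ?p"
    unfolding E1 E2 using det1 det2 by (simp_all add: measure_matrix_image_unit_ball powr_mult)
  ultimately show ?thesis
    unfolding det_F by (simp add: distrib_left)
qed

end
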